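(* Let $\varphi$ be a formula and $\Gamma$ a finite list of formulas of the language $\mathcal L$ described in the context. Then the sequent $\Gamma \Rightarrow \varphi$ is provable in the sequent calculus $\mathbf{FL}$ if and only if it is provable in the sequent calculus $\mathbf{FL}'$.
   Context: The language $\mathcal L$ has propositional variables, binary connectives $\to$, $\leftarrow$ (two implications), $\otimes$ (multiplicative conjunction), $\wedge$ (additive conjunction), $\vee$ (additive disjunction), unary connectives $\neg$, $\sim$ (two negations), and constants $\mathbf 1$ (unit of $\otimes$), $\mathbf 0$ (unit of multiplicative disjunction, which is not itself in the language), $\top$ (unit of $\wedge$) and $\bot$ (unit of $\vee$). Formulas are built from these in the usual way. A sequent has the form $\Gamma \Rightarrow C$, where $\Gamma$ is a finite (possibly empty) list of formulas and $C$ is either a single formula or empty. There are no structural rules of exchange, weakening or contraction. Below, $A,B$ are formulas, $\Gamma,\Gamma_1,\Gamma_2,\Gamma_3$ are finite lists of formulas, and $C$ is a right-hand side (at most one formula). A sequent is provable in a calculus if it has a finite derivation tree from the axioms by the rules. Calculus $\mathbf{FL}'$. Axioms: $A\Rightarrow A$; $\Rightarrow \mathbf 1$; $\mathbf 0\Rightarrow$; $\Gamma\Rightarrow\top$; $\bot,\Gamma\Rightarrow C$. Rules (upper sequents / lower sequent): ($\mathbf 1$W) $\Gamma\Rightarrow C$ / $\mathbf 1,\Gamma\Rightarrow C$; ($\mathbf 0$W) $\Gamma\Rightarrow$ / $\Gamma\Rightarrow\mathbf 0$; (Cut) $\Gamma_1\Rightarrow A$ and $\Gamma_2,A,\Gamma_3\Rightarrow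 C$ / $\Gamma_2,\Gamma_1,\Gamma_3\Rightarrow C$; ($\to$L) $\Gamma_1\Rightarrow A$ and $B,\Gamma_2\Rightarrow C$ / $\Gamma_1,A\to B,\Gamma_2\Rightarrow C$; ($\to$R) $A,\Gamma\Rightarrow B$ / $\Gamma\Rightarrow A\to B$; ($\leftarrow$L) $\Gamma_1\Rightarrow A$ and $B,\Gamma_2\Rightarrow C$ / $A\leftarrow B,\Gamma_1,\Gamma_2\Rightarrow C$; ($\leftarrow$R) $\Gamma,A\Rightarrow B$ / $\Gamma\Rightarrow A\leftarrow B$; ($\neg$L) $\Gamma\Rightarrow A$ / $\Gamma,\neg A\Rightarrow$; ($\neg$R) $A,\Gamma\Rightarrow$ / $\Gamma\Rightarrow\neg A$; ($\sim$L) $\Gamma\Rightarrow A$ / ${\sim}A,\Gamma\Rightarrow$; ($\sim$R) $\Gamma,A\Rightarrow$ / $\Gamma\Rightarrow{\sim}A$; ($\otimes$L) $A,B,\Gamma\Rightarrow C$ / $A\otimes B,\Gamma\Rightarrow C$; ($\otimes$R) $\Gamma_1\Rightarrow A$ and $\Gamma_2\Rightarrow B$ / $\Gamma_1,\Gamma_2\Rightarrow A\otimes B$; ($\wedge$L$_1$) $A,\Gamma\Rightarrow C$ / $A\wedge B,\Gamma\Rightarrow C$; ($\wedge$L$_2$) $B,\Gamma\Rightarrow C$ / $A\wedge B,\Gamma\Rightarrow C$; ($\wedge$R) $\Gamma\Rightarrow A$ and $\Gamma\Rightarrow B$ / $\Gamma\Rightarrow A\wedge B$; ($\vee$L) $A,\Gamma\Rightarrow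 C$ and $B,\Gamma\Rightarrow C$ / $A\vee B,\Gamma\Rightarrow C$; ($\vee$R$_1$) $\Gamma\Rightarrow A$ / $\Gamma\Rightarrow A\vee B$; ($\vee$R$_2$) $\Gamma\Rightarrow B$ / $\Gamma\Rightarrow A\vee B$. Calculus $\mathbf{FL}$ (Ono's Full Lambek calculus). Axioms: $A\Rightarrow A$; $\Rightarrow\mathbf 1$; $\mathbf 0\Rightarrow$; $\Gamma\Rightarrow\top$; $\Gamma_1,\bot,\Gamma_2\Rightarrow C$. Rules: ($\mathbf 1$W) $\Gamma_1,\Gamma_2\Rightarrow C$ / $\Gamma_1,\mathbf 1,\Gamma_2\Rightarrow C$; ($\mathbf 0$W) $\Gamma\Rightarrow$ / $\Gamma\Rightarrow\mathbf 0$; (Cut) as in $\mathbf{FL}'$; ($\to$L) $\Gamma_1\Rightarrow A$ and $\Gamma_2,B,\Gamma_3\Rightarrow C$ / $\Gamma_2,\Gamma_1,A\to B,\Gamma_3\Rightarrow C$; ($\to$R) $A,\Gamma\Rightarrow B$ / $\Gamma\Rightarrow A\to B$; ($\leftarrow$L) $\Gamma_1\Rightarrow A$ and $\Gamma_2,B,\Gamma_3\Rightarrow C$ / $\Gamma_2,A\leftarrow B,\Gamma_1,\Gamma_3\Rightarrow C$; ($\leftarrow$R) $\Gamma,A\Rightarrow B$ / $\Gamma\Rightarrow A\leftarrow B$; ($\neg$L) $\Gamma\Rightarrow A$ / $\Gamma,\neg A\Rightarrow$; ($\neg$R) $A,\Gamma\Rightarrow$ / $\Gamma\Rightarrow\neg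 A$; ($\sim$L) $\Gamma\Rightarrow A$ / ${\sim}A,\Gamma\Rightarrow$; ($\sim$R) $\Gamma,A\Rightarrow$ / $\Gamma\Rightarrow{\sim}A$; ($\otimes$L) $\Gamma_1,A,B,\Gamma_2\Rightarrow C$ / $\Gamma_1,A\otimes B,\Gamma_2\Rightarrow C$; ($\otimes$R) as in $\mathbf{FL}'$; ($\wedge$L$_1$) $\Gamma_1,A,\Gamma_2\Rightarrow C$ / $\Gamma_1,A\wedge B,\Gamma_2\Rightarrow C$; ($\wedge$L$_2$) $\Gamma_1,B,\Gamma_2\Rightarrow C$ / $\Gamma_1,A\wedge B,\Gamma_2\Rightarrow C$; ($\wedge$R) as in $\mathbf{FL}'$; ($\vee$L) $\Gamma_1,A,\Gamma_2\Rightarrow C$ and $\Gamma_1,B,\Gamma_2\Rightarrow C$ / $\Gamma_1,A\vee B,\Gamma_2\Rightarrow C$; ($\vee$R$_1$), ($\vee$R$_2$) as in $\mathbf{FL}'$. *)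

theory Defs
  imports Main
begin

datatype 'v formula =
    Var 'v
  | RImp "'v formula" "'v formula"  (infixr "\<^bold>\<rightarrow>" 55)
  | LImp "'v formula" "'v formula"  (infixr "\<^bold>\<leftarrow>" 55)
  | Tensor "'v formula" "'v formula"  (infixr "\<^bold>\<otimes>" 65)
  | Conj "'v formula" "'v formula"  (infixr "\<^bold>\<and>" 60)
  | Disj "'v formula" "'v formula"  (infixr "\<^bold>\<or>" 60)
  | Neg "'v formula"  ("\<^bold>\<not> _" [75] 75)
  | Tilde "'v formula"  ("\<^bold>\<sim> _" [75] 75)
  | One  ("\<^bold>1")
  | Zero  ("\<^bold>0")
  | Top  ("\<^bold>\<top>")
  | Bot  ("\<^bold>\<bottom>")

text \<open>
  A sequent is given by its antecedent, a list, and its succedent, where \<open>None\<close> is the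
  empty right-hand side. In both \<open>A \<^bold>\<rightarrow> B\<close> and \<open>A \<^bold>\<leftarrow> B\<close> the formula \<open>A\<close> is the antecedent and
  \<open>B\<close> the consequent of the implication: the two connectives differ in the side of the context
  on which \<open>A\<close> is discharged, not in the roles of their arguments.
\<close>

inductive FL' :: "'v formula list \<Rightarrow> 'v formula option \<Rightarrow> bool" where
  Id: "FL' [A] (Some A)"
| OneR: "FL' [] (Some \<^bold>1)"
| ZeroL: "FL' [\<^bold>0] None"
| TopR: "FL' \<Gamma> (Some \<^bold>\<top>)"
| BotL: "FL' (\<^bold>\<bottom> # \<Gamma>) C"
| OneW: "FL' \<Gamma> C \<Longrightarrow> FL' (\<^bold>1 # \<Gamma>) C"
| ZeroW: "FL' \<Gamma> None \<Longrightarrow> FL' \<Gamma> (Some \<^bold>0)"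
| Cut: "FL' \<Gamma>\<^sub>1 (Some A) \<Longrightarrow> FL' (\<Gamma>\<^sub>2 @ [A] @ \<Gamma>\<^sub>3) C \<Longrightarrow> FL' (\<Gamma>\<^sub>2 @ \<Gamma>\<^sub>1 @ \<Gamma>\<^sub>3) C"
| RImpL: "FL' \<Gamma>\<^sub>1 (Some A) \<Longrightarrow> FL' (B # \<Gamma>\<^sub>2) C \<Longrightarrow> FL' (\<Gamma>\<^sub>1 @ [A \<^bold>\<rightarrow> B] @ \<Gamma>\<^sub>2) C"
| RImpR: "FL' (A # \<Gamma>) (Some B) \<Longrightarrow> FL' \<Gamma> (Some (A \<^bold>\<rightarrow> B))"
| LImpL: "FL' \<Gamma>\<^sub>1 (Some A) \<Longrightarrow> FL' (B # \<Gamma>\<^sub>2) C \<Longrightarrow> FL' ([A \<^bold>\<leftarrow> B] @ \<Gamma>\<^sub>1 @ \<Gamma>\<^sub>2) C"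
| LImpR: "FL' (\<Gamma> @ [A]) (Some B) \<Longrightarrow> FL' \<Gamma> (Some (A \<^bold>\<leftarrow> B))"
| NegL: "FL' \<Gamma> (Some A) \<Longrightarrow> FL' (\<Gamma> @ [\<^bold>\<not> A]) None"
| NegR: "FL' (A # \<Gamma>) None \<Longrightarrow> FL' \<Gamma> (Some (\<^bold>\<not> A))"
| TildeL: "FL' \<Gamma> (Some A) \<Longrightarrow> FL' (\<^bold>\<sim> A # \<Gamma>) None"
| TildeR: "FL' (\<Gamma> @ [A]) None \<Longrightarrow> FL' \<Gamma> (Some (\<^bold>\<sim> A))"
| TensorL: "FL' ([A, B] @ \<Gamma>) C \<Longrightarrow> FL' ((A \<^bold>\<otimes> B) # \<Gamma>) C"
| TensorR: "FL' \<Gamma>\<^sub>1 (Some A) \<Longrightarrow> FL' \<Gamma>\<^sub>2 (Some B) \<Longrightarrow> FL' (\<Gamma>\<^sub>1 @ \<Gamma>\<^sub>2) (Some (A \<^bold>\<otimes> B))"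
| ConjL1: "FL' (A # \<Gamma>) C \<Longrightarrow> FL' ((A \<^bold>\<and> B) # \<Gamma>) C"
| ConjL2: "FL' (B # \<Gamma>) C \<Longrightarrow> FL' ((A \<^bold>\<and> B) # \<Gamma>) C"
| ConjR: "FL' \<Gamma> (Some A) \<Longrightarrow> FL' \<Gamma> (Some B) \<Longrightarrow> FL' \<Gamma> (Some (A \<^bold>\<and> B))"
| DisjL: "FL' (A # \<Gamma>) C \<Longrightarrow> FL' (B # \<Gamma>) C \<Longrightarrow> FL' ((A \<^bold>\<or> B) # \<Gamma>) C"
| DisjR1: "FL' \<Gamma> (Some A) \<Longrightarrow> FL' \<Gamma> (Some (A \<^bold>\<or> B))"
| DisjR2: "FL' \<Gamma> (Some B) \<Longrightarrow> FL' \<Gamma> (Some (A \<^bold>\<or> B))"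

inductive FL :: "'v formula list \<Rightarrow> 'v formula option \<Rightarrow> bool" where
  Id: "FL [A] (Some A)"
| OneR: "FL [] (Some \<^bold>1)"
| ZeroL: "FL [\<^bold>0] None"
| TopR: "FL \<Gamma> (Some \<^bold>\<top>)"
| BotL: "FL (\<Gamma>\<^sub>1 @ [\<^bold>\<bottom>] @ \<Gamma>\<^sub>2) C"
| OneW: "FL (\<Gamma>\<^sub>1 @ \<Gamma>\<^sub>2) C \<Longrightarrow> FL (\<Gamma>\<^sub>1 @ [\<^bold>1] @ \<Gamma>\<^sub>2) C"
| ZeroW: "FL \<Gamma> None \<Longrightarrow> FL \<Gamma> (Some \<^bold>0)"
| Cut: "FL \<Gamma>\<^sub>1 (Some A) \<Longrightarrow> FL (\<Gamma>\<^sub>2 @ [A] @ \<Gamma>\<^sub>3) C \<Longrightarrow> FL (\<Gamma>\<^sub>2 @ \<Gamma>\<^sub>1 @ \<Gamma>\<^sub>3) C"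
| RImpL: "FL \<Gamma>\<^sub>1 (Some A) \<Longrightarrow> FL (\<Gamma>\<^sub>2 @ [B] @ \<Gamma>\<^sub>3) C \<Longrightarrow> FL (\<Gamma>\<^sub>2 @ \<Gamma>\<^sub>1 @ [A \<^bold>\<rightarrow> B] @ \<Gamma>\<^sub>3) C"
| RImpR: "FL (A # \<Gamma>) (Some B) \<Longrightarrow> FL \<Gamma> (Some (A \<^bold>\<rightarrow> B))"
| LImpL: "FL \<Gamma>\<^sub>1 (Some A) \<Longrightarrow> FL (\<Gamma>\<^sub>2 @ [B] @ \<Gamma>\<^sub>3) C \<Longrightarrow> FL (\<Gamma>\<^sub>2 @ [A \<^bold>\<leftarrow> B] @ \<Gamma>\<^sub>1 @ \<Gamma>\<^sub>3) C"
| LImpR: "FL (\<Gamma> @ [A]) (Some B) \<Longrightarrow> FL \<Gamma> (Some (A \<^bold>\<leftarrow> B))"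
| NegL: "FL \<Gamma> (Some A) \<Longrightarrow> FL (\<Gamma> @ [\<^bold>\<not> A]) None"
| NegR: "FL (A # \<Gamma>) None \<Longrightarrow> FL \<Gamma> (Some (\<^bold>\<not> A))"
| TildeL: "FL \<Gamma> (Some A) \<Longrightarrow> FL (\<^bold>\<sim> A # \<Gamma>) None"
| TildeR: "FL (\<Gamma> @ [A]) None \<Longrightarrow> FL \<Gamma> (Some (\<^bold>\<sim> A))"
| TensorL: "FL (\<Gamma>\<^sub>1 @ [A, B] @ \<Gamma>\<^sub>2) C \<Longrightarrow> FL (\<Gamma>\<^sub>1 @ [A \<^bold>\<otimes> B] @ \<Gamma>\<^sub>2) C"
| TensorR: "FL \<Gamma>\<^sub>1 (Some A) \<Longrightarrow> FL \<Gamma>\<^sub>2 (Some B) \<Longrightarrow> FL (\<Gamma>\<^sub>1 @ \<Gamma>\<^sub>2) (Some (A \<^bold>\<otimes> B))"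
| ConjL1: "FL (\<Gamma>\<^sub>1 @ [A] @ \<Gamma>\<^sub>2) C \<Longrightarrow> FL (\<Gamma>\<^sub>1 @ [A \<^bold>\<and> B] @ \<Gamma>\<^sub>2) C"
| ConjL2: "FL (\<Gamma>\<^sub>1 @ [B] @ \<Gamma>\<^sub>2) C \<Longrightarrow> FL (\<Gamma>\<^sub>1 @ [A \<^bold>\<and> B] @ \<Gamma>\<^sub>2) C"
| ConjR: "FL \<Gamma> (Some A) \<Longrightarrow> FL \<Gamma> (Some B) \<Longrightarrow> FL \<Gamma> (Some (A \<^bold>\<and> B))"
| DisjL: "FL (\<Gamma>\<^sub>1 @ [A] @ \<Gamma>\<^sub>2) C \<Longrightarrow> FL (\<Gamma>\<^sub>1 @ [B] @ \<Gamma>\<^sub>2) C \<Longrightarrow> FL (\<Gamma>\<^sub>1 @ [A \<^bold>\<or> B] @ \<Gamma>\<^sub>2) C"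
| DisjR1: "FL \<Gamma> (Some A) \<Longrightarrow> FL \<Gamma> (Some (A \<^bold>\<or> B))"
| DisjR2: "FL \<Gamma> (Some B) \<Longrightarrow> FL \<Gamma> (Some (A \<^bold>\<or> B))"

end

theory Submission
  imports Defs
begin

text \<open>
  By residuation in \<open>FL'\<close>, a left context can be moved to the succedent:
  \<open>X # \<Gamma> \<Rightarrow> B\<close> is equivalent to \<open>\<Gamma> \<Rightarrow> X \<^bold>\<rightarrow> B\<close>, and \<open>X # \<Gamma> \<Rightarrow>\<close> to \<open>\<Gamma> \<Rightarrow> \<^bold>\<not> X\<close>. Each left rule of \<open>FL\<close>
  acting in the middle of an antecedent thus reduces to its \<open>FL'\<close> counterpart acting at the front.
\<close>

lemma FL'_RImp_iff: "FL' \<Gamma> (Some (A \<^bold>\<rightarrow> B)) \<longleftrightarrow> FL' (A # \<Gamma>) (Some B)"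
proof
  assume "FL' \<Gamma> (Some (A \<^bold>\<rightarrow> B))"
  \<comment> \<open>Cutting against this internal modus ponens inverts \<open>RImpR\<close>.\<close>
  moreover have "FL' ([A] @ [A \<^bold>\<rightarrow> B] @ []) (Some B)"
    by (intro FL'.RImpL FL'.Id)
  ultimately show "FL' (A # \<Gamma>) (Some B)"
    using FL'.Cut[of \<Gamma> "A \<^bold>\<rightarrow> B" "[A]" "[]"] by simp
qed (rule FL'.RImpR)

lemma FL'_Neg_iff: "FL' \<Gamma> (Some (\<^bold>\<not> A)) \<longleftrightarrow> FL' (A # \<Gamma>) None"
proof
  assume "FL' \<Gamma> (Some (\<^bold>\<not> A))"
  moreover have "FL' ([A] @ [\<^bold>\<not> A]) None"
    by (intro FL'.NegL FL'.Id)
  ultimately show "FL' (A # \<Gamma>) None"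
    using FL'.Cut[of \<Gamma> "\<^bold>\<not> A" "[A]" "[]"] by simp
qed (rule FL'.NegR)

text \<open>The formulas of \<open>\<Gamma>\<close> are moved to the right one by one, from the
  left; \<open>D\<close> is the resulting nested implication, with a negation innermost if
  \<open>C\<close> is empty and \<open>\<Gamma>\<close> is not. Since \<open>D\<close> does not
  depend on \<open>\<Delta>\<close>, it serves the premises and the conclusion of a rule
  alike.\<close>

lemma FL'_absorb_left_context: "\<exists>D. \<forall>\<Delta>. FL' (\<Gamma> @ \<Delta>) C \<longleftrightarrow> FL' \<Delta> D"
proof (induction \<Gamma> arbitrary: C)
  case Nil
  then show ?case by auto
next
  case (Cons X \<Gamma>)
  have "\<exists>E. \<forall>\<Delta>. FL' (X # \<Delta>) C \<longleftrightarrow> FL' \<Delta> E"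
    by (cases C) (metis FL'_Neg_iff, metis FL'_RImp_iff)
  then show ?case
    \<comment> \<open>The hypothesis is used at the new succedent \<open>E\<close>, hence the
      generalization over \<open>C\<close>.\<close>
    using Cons.IH by (metis append_Cons)
qed

lemma FL_imp_FL': "FL \<Gamma> C \<Longrightarrow> FL' \<Gamma> C"
proof (induction rule: FL.induct)
  case (BotL \<Gamma>\<^sub>1 \<Gamma>\<^sub>2 C)
  obtain D where "\<And>\<Delta>. FL' (\<Gamma>\<^sub>1 @ \<Delta>) C \<longleftrightarrow> FL' \<Delta> D"
    using FL'_absorb_left_context by blast
  then show ?case by (simp add: FL'.BotL)
next
  case (OneW \<Gamma>\<^sub>1 \<Gamma>\<^sub>2 C)
  obtain D where "\<And>\<Delta>. FL' (\<Gamma>\<^sub>1 @ \<Delta>) C \<longleftrightarrow> FL' \<Delta> D"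
    using FL'_absorb_left_context by blast
  with OneW show ?case by (simp add: FL'.OneW)
next
  case (RImpL \<Gamma>\<^sub>1 A \<Gamma>\<^sub>2 B \<Gamma>\<^sub>3 C)
  obtain D where "\<And>\<Delta>. FL' (\<Gamma>\<^sub>2 @ \<Delta>) C \<longleftrightarrow> FL' \<Delta> D"
    using FL'_absorb_left_context by blast
  \<comment> \<open>With \<open>\<Gamma>\<^sub>2\<close> absorbed into \<open>D\<close>, the
    principal premise starts with \<open>B\<close>, as the front rule requires.\<close>
  with RImpL show ?case using FL'.RImpL[of \<Gamma>\<^sub>1 A B \<Gamma>\<^sub>3 D] by simp
next
  case (LImpL \<Gamma>\<^sub>1 A \<Gamma>\<^sub>2 B \<Gamma>\<^sub>3 C)
  obtain D where "\<And>\<Delta>. FL' (\<Gamma>\<^sub>2 @ \<Delta>) C \<longleftrightarrow> FL' \<Delta> D"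
    using FL'_absorb_left_context by blast
  with LImpL show ?case using FL'.LImpL[of \<Gamma>\<^sub>1 A B \<Gamma>\<^sub>3 D] by simp
next
  case (TensorL \<Gamma>\<^sub>1 A B \<Gamma>\<^sub>2 C)
  obtain D where "\<And>\<Delta>. FL' (\<Gamma>\<^sub>1 @ \<Delta>) C \<longleftrightarrow> FL' \<Delta> D"
    using FL'_absorb_left_context by blast
  with TensorL show ?case by (simp add: FL'.TensorL)
next
  case (ConjL1 \<Gamma>\<^sub>1 A \<Gamma>\<^sub>2 C B)
  obtain D where "\<And>\<Delta>. FL' (\<Gamma>\<^sub>1 @ \<Delta>) C \<longleftrightarrow> FL' \<Delta> D"
    using FL'_absorb_left_context by blast
  with ConjL1 show ?case by (simp add: FL'.ConjL1)
next
  case (ConjL2 \<Gamma>\<^sub>1 B \<Gamma>\<^sub>2 C A)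
  obtain D where "\<And>\<Delta>. FL' (\<Gamma>\<^sub>1 @ \<Delta>) C \<longleftrightarrow> FL' \<Delta> D"
    using FL'_absorb_left_context by blast
  with ConjL2 show ?case by (simp add: FL'.ConjL2)
next
  case (DisjL \<Gamma>\<^sub>1 A \<Gamma>\<^sub>2 C B)
  obtain D where "\<And>\<Delta>. FL' (\<Gamma>\<^sub>1 @ \<Delta>) C \<longleftrightarrow> FL' \<Delta> D"
    using FL'_absorb_left_context by blast
  with DisjL show ?case by (simp add: FL'.DisjL)
\<comment> \<open>The remaining rules are the same in both calculi.\<close>
qed (blast intro: FL'.intros)+

text \<open>Where the calculi differ, the rule of \<open>FL'\<close> is that of \<open>FL\<close>
  with empty left context.\<close>

lemma FL'_imp_FL: "FL' \<Gamma> C \<Longrightarrow> FL \<Gamma> C"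
proof (induction rule: FL'.induct)
  case (BotL \<Gamma> C)
  show ?case using FL.BotL[of "[]"] by simp
next
  case (OneW \<Gamma> C)
  then show ?case using FL.OneW[of "[]"] by simp
next
  case (RImpL \<Gamma>\<^sub>1 A B \<Gamma>\<^sub>2 C)
  then show ?case using FL.RImpL[of _ _ "[]"] by simp
next
  case (LImpL \<Gamma>\<^sub>1 A B \<Gamma>\<^sub>2 C)
  then show ?case using FL.LImpL[of _ _ "[]"] by simp
next
  case (TensorL A B \<Gamma> C)
  then show ?case using FL.TensorL[of "[]"] by simp
next
  case (ConjL1 A \<Gamma> C B)
  then show ?case using FL.ConjL1[of "[]"] by simp
next
  case (ConjL2 B \<Gamma> C A)
  then show ?case using FL.ConjL2[of "[]"] by simp
next
  case (DisjL A \<Gamma> C B)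
  then show ?case using FL.DisjL[of "[]"] by simp
qed (blast intro: FL.intros)+

theorem mainTheorem1:
  fixes \<phi> :: "'v formula" and \<Gamma> :: "'v formula list"
  shows "FL \<Gamma> (Some \<phi>) \<longleftrightarrow> FL' \<Gamma> (Some \<phi>)"
  using FL_imp_FL' FL'_imp_FL by blast

end
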